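(* Let $Y, X, S, \hat{S}, \hat{Y}, C$ be random variables (inference target, source data, encoded symbols, received corrupted symbols, inferred output, channel feedback), with values denoted $\boldsymbol{y}, \boldsymbol{x}, \boldsymbol{s}, \hat{\boldsymbol{s}}, \hat{\boldsymbol{y}}, c$, and assume that they satisfy the Markov chain with directed edges $Y\to X\to S\to \hat{S}\to\hat{Y}$ and $C\to\hat{S}$; in particular $p(\hat{S}\mid X,Y,C)=p(\hat{S}\mid X,C)$. Let $$\mathcal{L}^{(\mathrm{IB})} := -I(\hat{S};Y)+\beta\, I(\hat{S};X,C).$$ Let $q_{\phi}(\boldsymbol{y}\mid\hat{\boldsymbol{s}})$ (the decoder) be a variational approximation to $p(\boldsymbol{y}\mid\hat{\boldsymbol{s}})$, let $p_{\theta}(\hat{\boldsymbol{s}}\mid\boldsymbol{x},c)$ (the encoder) be a variational approximation to $p(\hat{\boldsymbol{s}}\mid\boldsymbol{x},c)$, and let $r(\hat{\boldsymbol{s}})$ be a variational approximation to the marginal $p(\hat{\boldsymbol{s}})=\int_{\boldsymbol{x},c}p(\hat{\boldsymbol{s}}\mid\boldsymbol{x},c)\,p(\boldsymbol{x})\,p(c)\,d\boldsymbol{x}\,dc$. Then an upper bound of $\mathcal{L}^{(\mathrm{IB})}$ is given by $$\mathcal{L}^{(\mathrm{VIB})} := \mathbb{E}_{p(\boldsymbol{x},\boldsymbol{y},c)}\Big(-\mathbb{E}_{p_{\theta}(\hat{\boldsymbol{s}}\mid\boldsymbol{x},c)}\big[\log q_{\phi}(\boldsymbol{y}\mid\hat{\boldsymbol{s}})\big]+\beta\,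 \mathcal{D}_{\mathcal{K}\mathcal{L}}\big(p_{\theta}(\hat{\boldsymbol{s}}\mid\boldsymbol{x},c)\,\|\,r(\hat{\boldsymbol{s}})\big)\Big)\ \geq\ \mathcal{L}^{(\mathrm{IB})}.$$
   Context: $p(\cdot)$ denotes the true (joint, marginal or conditional) densities of the random variables named by its arguments. The Markov chain assumption is given by a directed graph whose only edges are $Y\to X$, $X\to S$, $S\to\hat{S}$, $C\to\hat{S}$, $\hat{S}\to\hat{Y}$, i.e. the joint density factorizes as $p(\boldsymbol{y})\,p(\boldsymbol{x}\mid\boldsymbol{y})\,p(c)\,p(\boldsymbol{s}\mid\boldsymbol{x})\,p(\hat{\boldsymbol{s}}\mid\boldsymbol{s},c)\,p(\hat{\boldsymbol{y}}\mid\hat{\boldsymbol{s}})$. $I(\cdot\,;\cdot)$ denotes mutual information, and $I(\hat{S};X,C)$ is the mutual information between $\hat{S}$ and the pair $(X,C)$. $\mathcal{D}_{\mathcal{K}\mathcal{L}}(p\|q)$ denotes the Kullback-Leibler divergence between the distributions $p$ and $q$. The term $-I(\hat{S};Y)$ is called the distortion, $I(\hat{S};X,C)$ the rate, and $\beta$ is the factor trading off rate against distortion. A variational approximation to a (conditional) density is a (conditional) density, here parametrized by $\phi$ or $\theta$ in the case of $q_\phi$ and $p_\theta$, used in place of the true one.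
   Formalization: Here β ≥ 0, the encoder p_θ is the actual conditional density of Ŝ given (X,C), H(Y) is finite and nonnegative (the bound can fail otherwise), and q(Y|Ŝ), r(Ŝ) are a.s. positive with log q(Y|Ŝ) and log(p_θ/r) integrable. *)

theory Defs
  imports "HOL-Probability.Probability"
begin

definition prob_density :: "'b measure \<Rightarrow> ('b \<Rightarrow> real) \<Rightarrow> bool" where
  "prob_density B f \<longleftrightarrow>
     f \<in> borel_measurable B \<and> (\<forall>b\<in>space B. 0 \<le> f b) \<and> (\<integral>\<^sup>+ b. ennreal (f b) \<partial>B) = 1"

text \<open>\<^term>\<open>k a b\<close> stands for $k(b \mid a)$: the conditioning value comes first.\<close>

definition cond_density :: "'a measure \<Rightarrow> 'b measure \<Rightarrow> ('a \<Rightarrow> 'b \<Rightarrow> real) \<Rightarrow> bool" where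
  "cond_density A B k \<longleftrightarrow>
     (\<lambda>(a, b). k a b) \<in> borel_measurable (A \<Otimes>\<^sub>M B) \<and> (\<forall>a\<in>space A. prob_density B (k a))"

text \<open>
  \<^term>\<open>k\<close> is a version of the conditional density $p(z \mid u)$ of \<^term>\<open>Z\<close> given \<^term>\<open>U\<close>, i.e. the joint
  law of \<^term>\<open>U\<close> and \<^term>\<open>Z\<close> is $p(du)\,k(z \mid u)\,dz$. This determines \<^term>\<open>k\<close> up to null sets
  of $p(du)\,dz$.
\<close>

definition cond_density_of ::
  "'w measure \<Rightarrow> 'a measure \<Rightarrow> 'b measure \<Rightarrow> ('w \<Rightarrow> 'a) \<Rightarrow> ('w \<Rightarrow> 'b) \<Rightarrow> ('a \<Rightarrow> 'b \<Rightarrow> real) \<Rightarrow> bool" where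
  "cond_density_of M A B U Z k \<longleftrightarrow>
     cond_density A B k \<and>
     distr M (A \<Otimes>\<^sub>M B) (\<lambda>w. (U w, Z w)) = density (distr M A U \<Otimes>\<^sub>M B) (\<lambda>(u, z). ennreal (k u z))"

text \<open>
  The joint density factorizes as
  $p(y)\,p(x \mid y)\,p(c)\,p(s \mid x)\,p(\hat s \mid s, c)\,p(\hat y \mid \hat s)$. As every factor
  is normalized, each of them is the density, or conditional density, its name says.
\<close>

definition markov_factorization where
  "markov_factorization M NY NX NC NS NSh NYh Y X C S Sh Yh pY pX pC pS pSh pYh \<longleftrightarrow>
     prob_density NY pY \<and> cond_density NY NX pX \<and> prob_density NC pC \<and>
     cond_density NX NS pS \<and> cond_density (NS \<Otimes>\<^sub>M NC) NSh pSh \<and> cond_density NSh NYh pYh \<and>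
     distributed M (NY \<Otimes>\<^sub>M NX \<Otimes>\<^sub>M NC \<Otimes>\<^sub>M NS \<Otimes>\<^sub>M NSh \<Otimes>\<^sub>M NYh)
       (\<lambda>w. (Y w, X w, C w, S w, Sh w, Yh w))
       (\<lambda>(y, x, c, s, sh, yh).
          ennreal (pY y * pX y x * pC c * pS x s * pSh (s, c) sh * pYh sh yh))"

definition L_IB where
  "L_IB M b NY NX NC NSh Y X C Sh \<beta> =
     - prob_space.mutual_information M b NSh NY Sh Y
     + \<beta> * prob_space.mutual_information M b NSh (NX \<Otimes>\<^sub>M NC) Sh (\<lambda>w. (X w, C w))"

text \<open>
  The library term \<^term>\<open>KL_divergence b P Q\<close> denotes the divergence of \<^term>\<open>Q\<close> from \<^term>\<open>P\<close>, in the usual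
  notation $D(Q \| P)$: the reference measure comes first.
\<close>

definition L_VIB where
  "L_VIB M b NY NX NC NSh Y X C \<beta> q p\<theta> r =
     (\<integral>(x, y, c).
        - (\<integral>sh. log b (q sh y) \<partial>density NSh (\<lambda>sh. ennreal (p\<theta> (x, c) sh)))
        + \<beta> * KL_divergence b (density NSh (\<lambda>sh. ennreal (r sh)))
                             (density NSh (\<lambda>sh. ennreal (p\<theta> (x, c) sh)))
      \<partial>distr M (NX \<Otimes>\<^sub>M NY \<Otimes>\<^sub>M NC) (\<lambda>w. (X w, Y w, C w)))"

text \<open>
  The bound drops the term $H(Y)$, which is harmless when $H(Y) \ge 0$. For a discrete \<^term>\<open>Y\<close> this
  holds automatically; a differential entropy can be negative.
\<close>

lemma entropy_count_space_nonneg: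
  assumes "information_space M b"
    and fe: "information_space.finite_entropy M b (count_space A) Y p"
  shows "0 \<le> prob_space.entropy M b (count_space A) Y"
proof -
  interpret information_space M b by fact
  have D: "distributed M (count_space A) Y (\<lambda>y. ennreal (p y))"
    using finite_entropy_distributed[OF fe] .
  have nn: "0 \<le> p y" if "y \<in> A" for y
    using finite_entropy_nn[OF fe] that by simp
  have le1: "p y \<le> 1" if y: "y \<in> A" for y
  proof -
    have "ennreal (p y) = (\<integral>\<^sup>+ z. ennreal (p z) * indicator {y} z \<partial>count_space A)"
      using y by simp
    also have "\<dots> = emeasure (density (count_space A) (\<lambda>z. ennreal (p z))) {y}"
      using y by (subst emeasure_density) auto
    also have "\<dots> = emeasure (distr M (count_space A) Y) {y}"
      using D by (simp add: distributed_def)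
    also have "\<dots> \<le> 1"
      using D y by (subst emeasure_distr) (auto simp: distributed_def intro: emeasure_le_1)
    finally show ?thesis by simp
  qed
  have "0 \<le> (\<integral>y. - (p y * log b (p y)) \<partial>count_space A)"
  proof (rule integral_nonneg_AE, rule AE_I2)
    fix y assume "y \<in> space (count_space A)"
    then have y: "0 \<le> p y" "p y \<le> 1" using nn le1 by auto
    then have "log b (p y) \<le> 0"
      using b_gt_1 by (cases "p y = 0") (auto simp: log_def divide_simps)
    then show "0 \<le> - (p y * log b (p y))"
      using y by (simp add: mult_nonneg_nonpos)
  qed
  then show ?thesis
    using entropy_distr[OF D] nn by simp
qed

end

theory Submission
  imports Defs
begin

text \<open>
  The Markov property gives $(X, Y, C, \hat S)$ the law $p(x, y, c)\,p_\theta(\hat s \mid x, c)$, so by Fubini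
  the variational loss is $- E \log q + \beta\, E \log (p_\theta / r)$. Let $m$ be the density of $\hat S$
  and $j$ the joint density of $(\hat S, Y)$. The bounds
  $E \log (p_\theta / r) \ge E \log (p_\theta / m) = I(\hat S; X, C)$ and
  $E \log q \le I(\hat S; Y) - H(Y)$ follow from $E \log Z \le 0$ when $E Z \le 1$, applied to
  $Z = r / m$ and $Z = q m / j$.

  The integral of a non-integrable function is 0 in the library, so the integrability of both information
  densities is needed. That of $\log (p_\theta / m)$ follows from that of $\log (p_\theta / r)$, and that of
  $\log (j / (m\,p_Y))$ follows by data processing: $E [j / (p_Y\,p_\theta)] \le 1$ bounds it from above
  by $\log (p_\theta / m)$ up to a term with integrable positive part.
\<close>

section \<open>Integrability and expectation of logarithms\<close>

text \<open>\<open>ennreal\<close> cuts negative values off, so the two bounds control positive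
  parts only. Where \<open>f\<close> is negative, its absolute value is \<open>g - (f + g)\<close>,
  hence at most the positive part of \<open>g\<close> plus the absolute value of
  \<open>f + g\<close>.\<close>

lemma integrable_summand:
  fixes f g :: "'a \<Rightarrow> real"
  assumes [measurable]: "f \<in> borel_measurable M" "g \<in> borel_measurable M"
    and f: "(\<integral>\<^sup>+ x. ennreal (f x) \<partial>M) < \<infinity>" and g: "(\<integral>\<^sup>+ x. ennreal (g x) \<partial>M) < \<infinity>"
    and fg: "integrable M (\<lambda>x. f x + g x)"
  shows "integrable M f"
proof (rule integrableI_bounded)
  have "(\<integral>\<^sup>+ x. ennreal (norm (f x)) \<partial>M)
      \<le> (\<integral>\<^sup>+ x. ennreal (f x) + (ennreal (norm (f x + g x)) + ennreal (g x)) \<partial>M)"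
  proof (rule nn_integral_mono)
    fix x
    show "ennreal (norm (f x)) \<le> ennreal (f x) + (ennreal (norm (f x + g x)) + ennreal (g x))"
    proof (cases "0 \<le> f x")
      case False
      have "ennreal (norm (f x)) \<le> ennreal (norm (f x + g x) + max 0 (g x))"
        using False by (intro ennreal_leI) auto
      also have "\<dots> = ennreal (norm (f x + g x)) + ennreal (g x)"
        by (subst ennreal_plus) (auto simp: max_def ennreal_neg)
      finally show ?thesis using False by (simp add: ennreal_neg)
    qed (simp add: add_increasing2)
  qed
  also have "\<dots> = (\<integral>\<^sup>+ x. ennreal (f x) \<partial>M)
      + ((\<integral>\<^sup>+ x. ennreal (norm (f x + g x)) \<partial>M) + (\<integral>\<^sup>+ x. ennreal (g x) \<partial>M))"
    by (subst nn_integral_add; simp add: nn_integral_add)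
  also have "\<dots> < \<infinity>"
    using f g fg by (simp add: integrable_iff_bounded less_top)
  finally show "(\<integral>\<^sup>+ x. ennreal (norm (f x)) \<partial>M) < \<infinity>" .
qed simp

lemma log_le_linear:
  assumes "1 < b" "0 < x"
  shows "log b x \<le> (x - 1) / ln b"
  using assms ln_le_minus_one[of x] by (simp add: log_def divide_right_mono)

context information_space
begin

text \<open>By \<open>log b z \<le> z / ln b\<close> the positive part of the logarithm is dominated
  by a multiple of \<open>Z\<close>. The negative part stays uncontrolled;
  \<open>integrable_summand\<close> makes up for that.\<close>

lemma nn_integral_log_finite:
  assumes [measurable]: "Z \<in> borel_measurable M"
    and pos: "AE x in M. 0 < Z x" and le1: "(\<integral>\<^sup>+ x. ennreal (Z x) \<partial>M) \<le> 1"
  shows "(\<integral>\<^sup>+ x. ennreal (log b (Z x)) \<partial>M) < \<infinity>"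
proof -
  have ln: "0 < ln b" using b_gt_1 by simp
  have "(\<integral>\<^sup>+ x. ennreal (log b (Z x)) \<partial>M) \<le> (\<integral>\<^sup>+ x. ennreal (1 / ln b) * ennreal (Z x) \<partial>M)"
  proof (rule nn_integral_mono_AE, use pos in eventually_elim)
    fix x assume x: "0 < Z x"
    have "log b (Z x) \<le> 1 / ln b * Z x"
      using log_le_linear[OF b_gt_1 x] ln by (simp add: diff_divide_distrib order_trans)
    then show "ennreal (log b (Z x)) \<le> ennreal (1 / ln b) * ennreal (Z x)"
      using x ln by (simp add: ennreal_mult[symmetric] ennreal_leI)
  qed
  also have "\<dots> = ennreal (1 / ln b) * (\<integral>\<^sup>+ x. ennreal (Z x) \<partial>M)"
    by (simp add: nn_integral_cmult)
  also have "\<dots> < \<infinity>"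
    using le1 by (auto simp: ennreal_mult_eq_top_iff less_top[symmetric] top_unique)
  finally show ?thesis .
qed

text \<open>Jensen's inequality for the logarithm, obtained from the tangent at 1:
  \<open>log b (Z x) \<le> (Z x - 1) / ln b\<close>, and the right-hand side has nonpositive
  expectation.\<close>

lemma expectation_log_nonpos:
  assumes [measurable]: "Z \<in> borel_measurable M"
    and pos: "AE x in M. 0 < Z x" and le1: "(\<integral>\<^sup>+ x. ennreal (Z x) \<partial>M) \<le> 1"
    and int: "integrable M (\<lambda>x. log b (Z x))"
  shows "expectation (\<lambda>x. log b (Z x)) \<le> 0"
proof -
  have ln: "0 < ln b" using b_gt_1 by simp
  have nn: "AE x in M. 0 \<le> Z x" using pos by eventually_elim simp
  have Z: "integrable M Z"
    using le1 nn by (intro integrableI_nonneg) (auto simp: less_top[symmetric] top_unique)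
  have "expectation (\<lambda>x. log b (Z x)) \<le> expectation (\<lambda>x. (Z x - 1) / ln b)"
    using pos log_le_linear[OF b_gt_1] by (intro integral_mono_AE int) (auto simp: Z elim!: eventually_mono)
  also have "\<dots> = (expectation Z - 1) / ln b"
    using Z by (simp add: prob_space)
  also have "\<dots> \<le> 0"
  proof -
    have "ennreal (expectation Z) \<le> 1"
      using le1 nn_integral_eq_integral[OF Z nn] by simp
    then have "expectation Z \<le> 1" by (simp add: ennreal_le_1)
    then show ?thesis using ln by (simp add: divide_nonpos_pos)
  qed
  finally show ?thesis .
qed

end

section \<open>Densities of laws and their ratios\<close>

text \<open>The law of \<open>Z\<close> is finite, so its Radon-Nikodym derivative is finite almost
  everywhere and has a real version.\<close>

lemma (in prob_space) absolutely_continuous_real_density: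
  assumes "sigma_finite_measure N" and Z: "Z \<in> measurable M N"
    and ac: "absolutely_continuous N (distr M N Z)"
  obtains g :: "_ \<Rightarrow> real" where "g \<in> borel_measurable N" "\<And>x. 0 \<le> g x"
    "distributed M N Z (\<lambda>x. ennreal (g x))"
proof -
  interpret N: sigma_finite_measure N by fact
  interpret Z: prob_space "distr M N Z" using Z by (rule prob_space_distr)
  obtain D where D: "D \<in> borel_measurable N" "AE x in N. RN_deriv N (distr M N Z) x = ennreal (D x)"
      "\<And>x. 0 \<le> D x"
    using N.real_RN_deriv[OF Z.finite_measure_axioms ac] by auto
  have "distr M N Z = density N (RN_deriv N (distr M N Z))"
    using N.density_RN_deriv[OF ac] by simp
  also have "\<dots> = density N (\<lambda>x. ennreal (D x))"
    using D by (intro density_cong) auto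
  finally show ?thesis
    using D Z by (intro that[of D]) (auto simp: distributed_def)
qed

text \<open>The zero set of a density is null for the law it describes. Almost sure positivity is
  what permits splitting the logarithms of ratios later.\<close>

lemma (in prob_space) distributed_AE_pos:
  fixes f :: "_ \<Rightarrow> real"
  assumes "distributed M N Z (\<lambda>x. ennreal (f x))" "f \<in> borel_measurable N"
  shows "AE w in M. 0 < f (Z w)"
  using assms by (subst distributed_AE2[of N Z "\<lambda>x. ennreal (f x)" "\<lambda>x. 0 < f x"]) auto

text \<open>Under the law of \<open>Z\<close> the denominator cancels against the density. Only an
  inequality remains, as the mass of \<open>g\<close> on the zero set of \<open>f\<close> is
  lost.\<close>

lemma (in prob_space) nn_integral_density_ratio_le:
  fixes f g :: "_ \<Rightarrow> real"
  assumes f: "distributed M N Z (\<lambda>x. ennreal (f x))" and [measurable]: "f \<in> borel_measurable N" "g \<in> borel_measurable N"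
    and g0: "\<And>x. x \<in> space N \<Longrightarrow> 0 \<le> g x" 
  shows "(\<integral>\<^sup>+ w. ennreal (g (Z w) / f (Z w)) \<partial>M) \<le> (\<integral>\<^sup>+ x. ennreal (g x) \<partial>N)"
proof -
  have "(\<integral>\<^sup>+ w. ennreal (g (Z w) / f (Z w)) \<partial>M) = (\<integral>\<^sup>+ x. ennreal (f x) * ennreal (g x / f x) \<partial>N)"
    by (rule distributed_nn_integral[OF f, symmetric]) measurable
  also have "\<dots> \<le> (\<integral>\<^sup>+ x. ennreal (g x) \<partial>N)"
  proof (rule nn_integral_mono)
    fix x assume x: "x \<in> space N"
    show "ennreal (f x) * ennreal (g x / f x) \<le> ennreal (g x)"
      using g0[OF x]
      by (cases "0 < f x") (auto simp: ennreal_mult[symmetric] ennreal_neg)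
  qed
  finally show ?thesis .
qed

lemma prob_densityD:
  assumes "prob_density B f"
  shows "f \<in> borel_measurable B" "\<And>b. b \<in> space B \<Longrightarrow> 0 \<le> f b" "(\<integral>\<^sup>+ b. ennreal (f b) \<partial>B) = 1"
  using assms by (auto simp: prob_density_def)

lemma cond_densityD:
  assumes "cond_density A B k"
  shows "(\<lambda>(a, b). k a b) \<in> borel_measurable (A \<Otimes>\<^sub>M B)"
    and "\<And>a b. a \<in> space A \<Longrightarrow> b \<in> space B \<Longrightarrow> 0 \<le> k a b"
    and "\<And>a. a \<in> space A \<Longrightarrow> k a \<in> borel_measurable B"
    and "\<And>a. a \<in> space A \<Longrightarrow> (\<integral>\<^sup>+ b. ennreal (k a b) \<partial>B) = 1"
  using assms by (auto simp: cond_density_def prob_density_def)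

lemma cond_density_measurable:
  assumes "cond_density A B k" "g \<in> measurable L A" "h \<in> measurable L B"
  shows "(\<lambda>w. k (g w) (h w)) \<in> borel_measurable L"
  using measurable_compose[OF measurable_Pair[OF assms(2,3)] cond_densityD(1)[OF assms(1)]] by simp

section \<open>Variables with a conditional density\<close>

text \<open>The law of \<open>U\<close> itself serves as the reference measure of the first
  coordinate. The locale is used with \<open>Z = Sh\<close> and with \<open>U\<close> either the
  pair (X, C) or the triple (X, Y, C).\<close>

locale conditional_density = prob_space M + B: sigma_finite_measure B
  for M :: "'w measure" and B :: "'b measure" +
  fixes A :: "'a measure" and U :: "'w \<Rightarrow> 'a" and Z :: "'w \<Rightarrow> 'b" and k :: "'a \<Rightarrow> 'b \<Rightarrow> real"
  assumes U[measurable]: "U \<in> measurable M A" and Z[measurable]: "Z \<in> measurable M B"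
    and cdo: "cond_density_of M A B U Z k"
begin

sublocale U: prob_space "distr M A U" by (rule prob_space_distr) simp
sublocale UB: pair_sigma_finite "distr M A U" B ..

lemma cond_density_k: "cond_density A B k" using cdo by (simp add: cond_density_of_def)

lemmas k_nonneg = cond_densityD(2)[OF cond_density_k]
lemmas k_measurable[measurable (raw)] = cond_density_measurable[OF cond_density_k]

lemma distributed_pair:
  "distributed M (distr M A U \<Otimes>\<^sub>M B) (\<lambda>w. (U w, Z w)) (\<lambda>(u, z). ennreal (k u z))"
proof -
  \<comment> \<open>The target of \<open>distr\<close> matters only through its sets, and
    \<open>distr M A U\<close> has the sets of \<open>A\<close>.\<close>
  have [simp]: "distr M (distr M A U \<Otimes>\<^sub>M B) f = distr M (A \<Otimes>\<^sub>M B) f" for f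
    by (intro distr_cong sets_pair_measure_cong) auto
  show ?thesis using cdo by (simp add: distributed_def cond_density_of_def)
qed

lemma nn_integral_pair:
  assumes [measurable]: "F \<in> borel_measurable (A \<Otimes>\<^sub>M B)"
  shows "(\<integral>\<^sup>+ w. F (U w, Z w) \<partial>M) = (\<integral>\<^sup>+ w. (\<integral>\<^sup>+ z. ennreal (k (U w) z) * F (U w, z) \<partial>B) \<partial>M)"
proof -
  have "(\<integral>\<^sup>+ w. F (U w, Z w) \<partial>M) = (\<integral>\<^sup>+ p. (case p of (u, z) \<Rightarrow> ennreal (k u z)) * F p \<partial>(distr M A U \<Otimes>\<^sub>M B))"
    by (rule distributed_nn_integral[OF distributed_pair, symmetric]) simp
  also have "\<dots> = (\<integral>\<^sup>+ u. (\<integral>\<^sup>+ z. ennreal (k u z) * F (u, z) \<partial>B) \<partial>distr M A U)"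
    by (subst B.nn_integral_fst[symmetric]) auto
  also have "\<dots> = (\<integral>\<^sup>+ w. (\<integral>\<^sup>+ z. ennreal (k (U w) z) * F (U w, z) \<partial>B) \<partial>M)"
    by (subst nn_integral_distr) auto
  finally show ?thesis .
qed

text \<open>Disintegration turns division by \<open>k\<close> into a cancellation inside the inner
  integral. Points where \<open>k\<close> vanishes contribute 0 on the left, hence only an
  inequality.\<close>

lemma nn_integral_quotient_le:
  fixes F :: "'a \<times> 'b \<Rightarrow> real"
  assumes [measurable]: "F \<in> borel_measurable (A \<Otimes>\<^sub>M B)"
    and F: "\<And>p. p \<in> space (A \<Otimes>\<^sub>M B) \<Longrightarrow> 0 \<le> F p"
  shows "(\<integral>\<^sup>+ w. ennreal (F (U w, Z w) / k (U w) (Z w)) \<partial>M) \<le> (\<integral>\<^sup>+ w. \<integral>\<^sup>+ z. ennreal (F (U w, z)) \<partial>B \<partial>M)"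
proof -
  have "(\<integral>\<^sup>+ w. ennreal (F (U w, Z w) / k (U w) (Z w)) \<partial>M)
      = (\<integral>\<^sup>+ w. \<integral>\<^sup>+ z. ennreal (k (U w) z) * ennreal (F (U w, z) / k (U w) z) \<partial>B \<partial>M)"
    using nn_integral_pair[of "\<lambda>p. ennreal (F p / k (fst p) (snd p))"] by simp
  also have "\<dots> \<le> (\<integral>\<^sup>+ w. \<integral>\<^sup>+ z. ennreal (F (U w, z)) \<partial>B \<partial>M)"
  proof (intro nn_integral_mono)
    fix w z assume wz: "w \<in> space M" "z \<in> space B"
    then have "(U w, z) \<in> space (A \<Otimes>\<^sub>M B)"
      using measurable_space[OF U] by (simp add: space_pair_measure)
    from F[OF this] show "ennreal (k (U w) z) * ennreal (F (U w, z) / k (U w) z) \<le> ennreal (F (U w, z))"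
      by (cases "0 < k (U w) z") (auto simp: ennreal_mult[symmetric] ennreal_neg)
  qed
  finally show ?thesis .
qed

text \<open>Fubini for the joint density. The integrability of the inner integral is recorded as
  well: it lets the loss be split into its two terms in \<open>L_VIB_eq\<close>.\<close>

lemma integral_pair:
  assumes [measurable]: "F \<in> borel_measurable (A \<Otimes>\<^sub>M B)"
    and int: "integrable M (\<lambda>w. F (U w, Z w) :: real)"
  shows "integrable (distr M A U) (\<lambda>u. \<integral>z. k u z * F (u, z) \<partial>B)"
    and "(\<integral>u. (\<integral>z. k u z * F (u, z) \<partial>B) \<partial>distr M A U) = (\<integral>w. F (U w, Z w) \<partial>M)"
proof -
  let ?D = "distr M A U \<Otimes>\<^sub>M B"
  have nn: "0 \<le> (case p of (u, z) \<Rightarrow> k u z)" if "p \<in> space ?D" for p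
    using that k_nonneg by (auto simp: space_pair_measure)
  have D: "distributed M ?D (\<lambda>w. (U w, Z w)) (\<lambda>p. ennreal (case p of (u, z) \<Rightarrow> k u z))"
    using distributed_pair by (simp add: case_prod_beta')
  have "integrable ?D (\<lambda>p. (case p of (u, z) \<Rightarrow> k u z) * F p)"
    using int by (subst distributed_integrable[OF D _ nn]) auto
  from UB.integrable_fst'[OF this] UB.integral_fst'[OF this] distributed_integral[OF D _ nn, of F]
  show "integrable (distr M A U) (\<lambda>u. \<integral>z. k u z * F (u, z) \<partial>B)"
    and "(\<integral>u. (\<integral>z. k u z * F (u, z) \<partial>B) \<partial>distr M A U) = (\<integral>w. F (U w, Z w) \<partial>M)"
    by simp_all
qed

text \<open>Off the zero set of \<open>k\<close>, null sets of the joint law are null sets of the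
  product measure, and these have null sections. With \<open>P\<close> stating positivity of
  \<open>r\<close> this yields absolute continuity of the encoder with respect to \<open>r\<close>,
  for almost every condition.\<close>

lemma AE_pair:
  assumes [measurable]: "Measurable.pred (A \<Otimes>\<^sub>M B) P"
    and P: "AE w in M. P (U w, Z w)"
  shows "AE u in distr M A U. AE z in B. 0 < k u z \<longrightarrow> P (u, z)"
proof -
  have "AE p in distr M A U \<Otimes>\<^sub>M B. 0 < (case p of (u, z) \<Rightarrow> ennreal (k u z)) \<longrightarrow> P p"
    using P by (subst distributed_AE2[OF distributed_pair, symmetric]) auto
  from UB.AE_pair[OF this] show ?thesis by simp
qed

lemma AE_k_pos: "AE w in M. 0 < k (U w) (Z w)"
  using distributed_AE2[OF distributed_pair, of "\<lambda>(u, z). 0 < k u z"] by (simp add: case_prod_beta')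

text \<open>A null set has \<open>B\<close>-null sections at almost all values of the second
  coordinate. Absolute continuity carries this over to almost every value \<open>f (U w)\<close>,
  and there the conditional law of \<open>Z\<close> has a density, so it does not charge the
  section.\<close>

lemma absolutely_continuous_pair:
  assumes f[measurable]: "f \<in> measurable A N" and "sigma_finite_measure N"
    and ac: "absolutely_continuous N (distr M N (\<lambda>w. f (U w)))"
  shows "absolutely_continuous (B \<Otimes>\<^sub>M N) (distr M (B \<Otimes>\<^sub>M N) (\<lambda>w. (Z w, f (U w))))"
  unfolding absolutely_continuous_def
proof
  interpret N: sigma_finite_measure N by fact
  interpret BN: pair_sigma_finite B N ..
  fix E assume E: "E \<in> null_sets (B \<Otimes>\<^sub>M N)"
  then have [measurable]: "E \<in> sets (B \<Otimes>\<^sub>M N)" by auto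
  have "AE p in B \<Otimes>\<^sub>M N. p \<notin> E" using E by (rule AE_not_in)
  then have "AE z in B. AE y in N. (z, y) \<notin> E" by (rule BN.AE_pair)
  then have "AE y in N. AE z in B. (z, y) \<notin> E"
    by (subst (asm) BN.AE_commute) auto
  moreover have "AE y in distr M N (\<lambda>w. f (U w)). Q y" if "AE y in N. Q y" for Q
    using absolutely_continuous_AE[OF _ ac that] by simp
  ultimately have "AE y in distr M N (\<lambda>w. f (U w)). AE z in B. (z, y) \<notin> E" by blast
  then have ae: "AE w in M. AE z in B. (z, f (U w)) \<notin> E"
    by (rule AE_distrD[rotated]) simp
  have "emeasure (distr M (B \<Otimes>\<^sub>M N) (\<lambda>w. (Z w, f (U w)))) E
      = (\<integral>\<^sup>+ w. indicator E (Z w, f (U w)) \<partial>M)"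
    by (subst nn_integral_indicator[symmetric], simp, subst nn_integral_distr) auto
  also have "\<dots> = (\<integral>\<^sup>+ w. (\<integral>\<^sup>+ z. ennreal (k (U w) z) * indicator E (z, f (U w)) \<partial>B) \<partial>M)"
    using nn_integral_pair[of "\<lambda>(u, z). indicator E (z, f u)"] by simp
  also have "\<dots> = (\<integral>\<^sup>+ w. 0 \<partial>M)"
  proof (rule nn_integral_cong_AE, use ae in eventually_elim)
    fix w assume "AE z in B. (z, f (U w)) \<notin> E"
    then have "(\<integral>\<^sup>+ z. ennreal (k (U w) z) * indicator E (z, f (U w)) \<partial>B) = (\<integral>\<^sup>+ z. 0 \<partial>B)"
      by (intro nn_integral_cong_AE) auto
    then show "(\<integral>\<^sup>+ z. ennreal (k (U w) z) * indicator E (z, f (U w)) \<partial>B) = 0" by simp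
  qed
  finally show "E \<in> null_sets (distr M (B \<Otimes>\<^sub>M N) (\<lambda>w. (Z w, f (U w))))" by auto
qed

lemma absolutely_continuous_Z: "absolutely_continuous B (distr M B Z)"
  unfolding absolutely_continuous_def
proof
  fix E assume E: "E \<in> null_sets B"
  then have [measurable]: "E \<in> sets B" by auto
  have ae: "AE z in B. z \<notin> E" using E by (rule AE_not_in)
  have "emeasure (distr M B Z) E = (\<integral>\<^sup>+ w. indicator E (Z w) \<partial>M)"
    by (subst nn_integral_indicator[symmetric], simp, subst nn_integral_distr) auto
  also have "\<dots> = (\<integral>\<^sup>+ w. (\<integral>\<^sup>+ z. ennreal (k (U w) z) * indicator E z \<partial>B) \<partial>M)"
    using nn_integral_pair[of "\<lambda>(u, z). indicator E z"] by simp
  also have "\<dots> = (\<integral>\<^sup>+ w. (\<integral>\<^sup>+ z. 0 \<partial>B) \<partial>M)"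
    using ae by (intro nn_integral_cong nn_integral_cong_AE) auto
  finally show "E \<in> null_sets (distr M B Z)" by auto
qed

lemma mutual_information_eq:
  assumes "1 < b" and m: "distributed M B Z (\<lambda>z. ennreal (m z))" and m0: "\<And>z. 0 \<le> m z"
  shows "mutual_information b B A Z U = expectation (\<lambda>w. log b (k (U w) (Z w) / m (Z w)))"
proof -
  interpret information_space M b by standard fact
  \<comment> \<open>Mutual information depends on the base measure \<open>A\<close> only through its sets, so the law of \<open>U\<close> may replace
    it: then \<open>U\<close> has density 1, and no density of \<open>U\<close> with respect to \<open>A\<close> is required.\<close>
  let ?T = "distr M A U"
  have [measurable]: "m \<in> borel_measurable B"
    using distributed_real_measurable[OF _ m] m0 by simp
  have [simp]: "distr M ?T U = ?T" "distr M (B \<Otimes>\<^sub>M ?T) f = distr M (B \<Otimes>\<^sub>M A) f" for f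
    by (intro distr_cong sets_pair_measure_cong; simp)+
  have eq: "mutual_information b B A Z U = mutual_information b B ?T Z U"
    by (simp add: mutual_information_def)
  have T: "distributed M ?T U (\<lambda>_. ennreal 1)"
    by (simp add: distributed_def density_1)
  interpret BU: pair_sigma_finite ?T B ..
  have J: "distributed M (B \<Otimes>\<^sub>M ?T) (\<lambda>w. (Z w, U w)) (\<lambda>p. ennreal (case p of (z, u) \<Rightarrow> k u z))"
    using distributed_swap[OF U.sigma_finite_measure_axioms B.sigma_finite_measure_axioms distributed_pair]
    by (simp add: case_prod_beta')
  have nn: "0 \<le> (case p of (z, u) \<Rightarrow> k u z)" if "p \<in> space (B \<Otimes>\<^sub>M ?T)" for p
    using that k_nonneg by (auto simp: space_pair_measure)
  have "mutual_information b B ?T Z U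
      = (\<integral>p. (case p of (z, u) \<Rightarrow> k u z) * log b ((case p of (z, u) \<Rightarrow> k u z) / (m (fst p) * 1)) \<partial>(B \<Otimes>\<^sub>M ?T))"
    using k_nonneg m0 by (intro mutual_information_distr[OF B.sigma_finite_measure_axioms U.sigma_finite_measure_axioms m _ T _ J])
       auto
  also have "\<dots> = (\<integral>w. log b ((case (Z w, U w) of (z, u) \<Rightarrow> k u z) / (m (fst (Z w, U w)) * 1)) \<partial>M)"
    by (rule distributed_integral[OF J _ nn]) auto
  finally show ?thesis unfolding eq by simp
qed

end

section \<open>The Markov factorization and the conditional law of the received symbols\<close>

text \<open>The inner integral over \<open>s\<close> is the transition density from (x, c) to
  \<open>sh\<close>, the encoded symbol being integrated out; it does not involve \<open>y\<close>,
  which is the Markov property. Both sides reduce to the same iterated integral over the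
  factors.\<close>

lemma markov_factorization_nn_integral:
  fixes NY :: "'y measure" and NX :: "'x measure" and NC :: "'c measure"
    and NS :: "'s measure" and NSh :: "'t measure" and NYh :: "'u measure"
    and G :: "('x \<times> 'y \<times> 'c) \<times> 't \<Rightarrow> ennreal"
  assumes sf: "sigma_finite_measure NY" "sigma_finite_measure NX" "sigma_finite_measure NC"
        "sigma_finite_measure NS" "sigma_finite_measure NSh" "sigma_finite_measure NYh"
    and mf: "markov_factorization M NY NX NC NS NSh NYh Y X C S Sh Yh pY pX pC pS pSh pYh"
    and [measurable]: "G \<in> borel_measurable ((NX \<Otimes>\<^sub>M NY \<Otimes>\<^sub>M NC) \<Otimes>\<^sub>M NSh)"
  shows "(\<integral>\<^sup>+ w. G ((X w, Y w, C w), Sh w) \<partial>M) =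
    (\<integral>\<^sup>+ w. (\<integral>\<^sup>+ sh. (\<integral>\<^sup>+ s. ennreal (pS (X w) s * pSh (s, C w) sh) \<partial>NS) * G ((X w, Y w, C w), sh) \<partial>NSh) \<partial>M)"
proof -
  interpret NY: sigma_finite_measure NY by fact
  interpret NX: sigma_finite_measure NX by fact
  interpret NC: sigma_finite_measure NC by fact
  interpret NS: sigma_finite_measure NS by fact
  interpret NSh: sigma_finite_measure NSh by fact
  interpret NYh: sigma_finite_measure NYh by fact
  interpret P5: pair_sigma_finite NSh NYh ..
  interpret P4: pair_sigma_finite NS "NSh \<Otimes>\<^sub>M NYh" ..
  interpret P3: pair_sigma_finite NC "NS \<Otimes>\<^sub>M NSh \<Otimes>\<^sub>M NYh" ..
  interpret P2: pair_sigma_finite NX "NC \<Otimes>\<^sub>M NS \<Otimes>\<^sub>M NSh \<Otimes>\<^sub>M NYh" ..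
  interpret P1: pair_sigma_finite NY "NX \<Otimes>\<^sub>M NC \<Otimes>\<^sub>M NS \<Otimes>\<^sub>M NSh \<Otimes>\<^sub>M NYh" ..
  interpret Q: pair_sigma_finite NS NSh ..
  let ?N = "NY \<Otimes>\<^sub>M NX \<Otimes>\<^sub>M NC \<Otimes>\<^sub>M NS \<Otimes>\<^sub>M NSh \<Otimes>\<^sub>M NYh"
  let ?f = "\<lambda>(y, x, c, s, sh, yh). ennreal (pY y * pX y x * pC c * pS x s * pSh (s, c) sh * pYh sh yh)"
  from mf have pY: "prob_density NY pY" and pX: "cond_density NY NX pX" and pC: "prob_density NC pC"
    and pS: "cond_density NX NS pS" and pSh: "cond_density (NS \<Otimes>\<^sub>M NC) NSh pSh" and pYh: "cond_density NSh NYh pYh"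
    and D: "distributed M ?N (\<lambda>w. (Y w, X w, C w, S w, Sh w, Yh w)) ?f"
    by (simp_all add: markov_factorization_def)
  note [measurable] = prob_densityD(1)[OF pY] prob_densityD(1)[OF pC]
  note [measurable (raw)] = cond_density_measurable[OF pX] cond_density_measurable[OF pS]
    cond_density_measurable[OF pSh] cond_density_measurable[OF pYh]
  note nn = prob_densityD(2)[OF pY] prob_densityD(2)[OF pC] cond_densityD(2)[OF pX] cond_densityD(2)[OF pS]
    cond_densityD(2)[OF pSh] cond_densityD(2)[OF pYh]
  have [measurable]: "X \<in> measurable M NX" "Y \<in> measurable M NY" "C \<in> measurable M NC" "Sh \<in> measurable M NSh"
    using distributed_measurable[OF D] by (auto simp: measurable_pair_iff comp_def)
  have fm: "?f \<in> borel_measurable ?N" by measurable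
  define K where "K x c sh = (\<integral>\<^sup>+ s. ennreal (pS x s * pSh (s, c) sh) \<partial>NS)" for x c sh
  have [measurable (raw)]: "(\<lambda>v. K (f v) (g v) (h v)) \<in> borel_measurable L"
    if [measurable]: "f \<in> measurable L NX" "g \<in> measurable L NC" "h \<in> measurable L NSh" for f g h L
    unfolding K_def by measurable
  have main: "(\<integral>\<^sup>+ w. H ((X w, Y w, C w), Sh w) \<partial>M) =
      (\<integral>\<^sup>+ y. \<integral>\<^sup>+ x. \<integral>\<^sup>+ c. ennreal (pY y * pX y x * pC c) * (\<integral>\<^sup>+ sh. K x c sh * H ((x, y, c), sh) \<partial>NSh) \<partial>NC \<partial>NX \<partial>NY)"
    if [measurable]: "H \<in> borel_measurable ((NX \<Otimes>\<^sub>M NY \<Otimes>\<^sub>M NC) \<Otimes>\<^sub>M NSh)" for H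
  proof -
    let ?H = "\<lambda>(y, x, c, s, sh, yh). H ((x, y, c), sh)"
    have "(\<integral>\<^sup>+ w. H ((X w, Y w, C w), Sh w) \<partial>M) = (\<integral>\<^sup>+ p. ?f p * ?H p \<partial>?N)"
      by (subst distributed_nn_integral[OF D]) auto
    also have "\<dots> = (\<integral>\<^sup>+ y. \<integral>\<^sup>+ x. \<integral>\<^sup>+ c. \<integral>\<^sup>+ s. \<integral>\<^sup>+ sh. \<integral>\<^sup>+ yh. ?f (y, x, c, s, sh, yh) * ?H (y, x, c, s, sh, yh)
        \<partial>NYh \<partial>NSh \<partial>NS \<partial>NC \<partial>NX \<partial>NY)"
      \<comment> \<open>Each rewrite peels off the leftmost coordinate; \<open>P2\<close> to
        \<open>P5\<close> and \<open>NYh\<close> are the spaces of the coordinates that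
        remain.\<close>
      apply (subst P2.nn_integral_fst[symmetric], measurable)
      apply (rule nn_integral_cong, subst P3.nn_integral_fst[symmetric], measurable)
      apply (rule nn_integral_cong, subst P4.nn_integral_fst[symmetric], measurable)
      apply (rule nn_integral_cong, subst P5.nn_integral_fst[symmetric], measurable)
      apply (rule nn_integral_cong, subst NYh.nn_integral_fst[symmetric], measurable)
      done
    also have "\<dots> = (\<integral>\<^sup>+ y. \<integral>\<^sup>+ x. \<integral>\<^sup>+ c. ennreal (pY y * pX y x * pC c) * (\<integral>\<^sup>+ sh. K x c sh * H ((x, y, c), sh) \<partial>NSh) \<partial>NC \<partial>NX \<partial>NY)"
    proof (intro nn_integral_cong)
      fix y x c assume [simp]: "y \<in> space NY" "x \<in> space NX" "c \<in> space NC"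
      let ?D = "ennreal (pY y * pX y x * pC c)"
      have "(\<integral>\<^sup>+ s. \<integral>\<^sup>+ sh. \<integral>\<^sup>+ yh. ?f (y, x, c, s, sh, yh) * ?H (y, x, c, s, sh, yh) \<partial>NYh \<partial>NSh \<partial>NS)
          = (\<integral>\<^sup>+ s. \<integral>\<^sup>+ sh. ?D * (ennreal (pS x s * pSh (s, c) sh) * H ((x, y, c), sh)) \<partial>NSh \<partial>NS)"
      proof (intro nn_integral_cong)
        fix s sh assume [simp]: "s \<in> space NS" "sh \<in> space NSh"
        have "(\<integral>\<^sup>+ yh. ?f (y, x, c, s, sh, yh) * ?H (y, x, c, s, sh, yh) \<partial>NYh)
            = (\<integral>\<^sup>+ yh. ?D * (ennreal (pS x s * pSh (s, c) sh) * H ((x, y, c), sh)) * ennreal (pYh sh yh) \<partial>NYh)"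
          by (intro nn_integral_cong) (simp add: ennreal_mult nn space_pair_measure ac_simps)
        \<comment> \<open>The inferred output drops out because \<open>pYh sh\<close> has integral
          1.\<close>
        also have "\<dots> = ?D * (ennreal (pS x s * pSh (s, c) sh) * H ((x, y, c), sh))"
          by (subst nn_integral_cmult) (simp_all add: cond_densityD(3,4)[OF pYh])
        finally show "(\<integral>\<^sup>+ yh. ?f (y, x, c, s, sh, yh) * ?H (y, x, c, s, sh, yh) \<partial>NYh)
            = ?D * (ennreal (pS x s * pSh (s, c) sh) * H ((x, y, c), sh))" .
      qed
      also have "\<dots> = (\<integral>\<^sup>+ sh. \<integral>\<^sup>+ s. ?D * (ennreal (pS x s * pSh (s, c) sh) * H ((x, y, c), sh)) \<partial>NS \<partial>NSh)"
        by (rule Q.Fubini'[symmetric]) measurable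
      also have "\<dots> = (\<integral>\<^sup>+ sh. ?D * (K x c sh * H ((x, y, c), sh)) \<partial>NSh)"
        unfolding K_def
        by (rule nn_integral_cong, subst nn_integral_multc[symmetric], measurable, subst nn_integral_cmult, measurable)
      also have "\<dots> = ?D * (\<integral>\<^sup>+ sh. K x c sh * H ((x, y, c), sh) \<partial>NSh)"
        by (rule nn_integral_cmult) measurable
      finally show "(\<integral>\<^sup>+ s. \<integral>\<^sup>+ sh. \<integral>\<^sup>+ yh. ?f (y, x, c, s, sh, yh) * ?H (y, x, c, s, sh, yh) \<partial>NYh \<partial>NSh \<partial>NS)
          = ?D * (\<integral>\<^sup>+ sh. K x c sh * H ((x, y, c), sh) \<partial>NSh)" .
    qed
    finally show ?thesis .
  qed
  have K1: "(\<integral>\<^sup>+ sh. K x c sh \<partial>NSh) = 1" if [simp]: "x \<in> space NX" "c \<in> space NC" for x c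
  proof -
    have "(\<integral>\<^sup>+ sh. K x c sh \<partial>NSh) = (\<integral>\<^sup>+ s. \<integral>\<^sup>+ sh. ennreal (pS x s * pSh (s, c) sh) \<partial>NSh \<partial>NS)"
      unfolding K_def by (rule Q.Fubini') measurable
    also have "\<dots> = (\<integral>\<^sup>+ s. ennreal (pS x s) \<partial>NS)"
    proof (intro nn_integral_cong)
      fix s assume [simp]: "s \<in> space NS"
      have "(\<integral>\<^sup>+ sh. ennreal (pS x s * pSh (s, c) sh) \<partial>NSh) = (\<integral>\<^sup>+ sh. ennreal (pS x s) * ennreal (pSh (s, c) sh) \<partial>NSh)"
        by (intro nn_integral_cong) (simp add: ennreal_mult nn space_pair_measure)
      also have "\<dots> = ennreal (pS x s)"
        by (subst nn_integral_cmult) (simp_all add: cond_densityD(3,4)[OF pSh] space_pair_measure)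
      finally show "(\<integral>\<^sup>+ sh. ennreal (pS x s * pSh (s, c) sh) \<partial>NSh) = ennreal (pS x s)" .
    qed
    also have "\<dots> = 1" by (simp add: cond_densityD(4)[OF pS])
    finally show ?thesis .
  qed
  \<comment> \<open>\<open>?G\<close> averages \<open>G\<close> against \<open>K\<close> and ignores
    the last coordinate of its argument. In \<open>main\<close> the outer factor \<open>K\<close>
    then integrates to 1 by \<open>K1\<close>, and what is left is \<open>main\<close> for
    \<open>G\<close> itself.\<close>
  let ?G = "\<lambda>p :: ('x \<times> 'y \<times> 'c) \<times> 't. \<integral>\<^sup>+ sh. K (fst (fst p)) (snd (snd (fst p))) sh * G (fst p, sh) \<partial>NSh"
  have "(\<integral>\<^sup>+ w. (\<integral>\<^sup>+ sh. K (X w) (C w) sh * G ((X w, Y w, C w), sh) \<partial>NSh) \<partial>M)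
      = (\<integral>\<^sup>+ w. ?G ((X w, Y w, C w), Sh w) \<partial>M)" by simp
  also have "\<dots> = (\<integral>\<^sup>+ y. \<integral>\<^sup>+ x. \<integral>\<^sup>+ c. ennreal (pY y * pX y x * pC c) *
      (\<integral>\<^sup>+ sh. K x c sh * ?G ((x, y, c), sh) \<partial>NSh) \<partial>NC \<partial>NX \<partial>NY)"
    by (rule main) measurable
  also have "\<dots> = (\<integral>\<^sup>+ y. \<integral>\<^sup>+ x. \<integral>\<^sup>+ c. ennreal (pY y * pX y x * pC c) *
      (\<integral>\<^sup>+ sh. K x c sh * G ((x, y, c), sh) \<partial>NSh) \<partial>NC \<partial>NX \<partial>NY)"
    by (intro nn_integral_cong) (simp add: nn_integral_multc K1)
  also have "\<dots> = (\<integral>\<^sup>+ w. G ((X w, Y w, C w), Sh w) \<partial>M)"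
    by (rule main[symmetric]) measurable
  finally show ?thesis by (simp add: K_def)
qed

lemma markov_factorization_measurable:
  assumes "markov_factorization M NY NX NC NS NSh NYh Y X C S Sh Yh pY pX pC pS pSh pYh"
  shows "X \<in> measurable M NX" "Y \<in> measurable M NY" "C \<in> measurable M NC" "Sh \<in> measurable M NSh"
  using assms
  by (auto simp: markov_factorization_def measurable_pair_iff comp_def dest!: distributed_measurable)

text \<open>This is p(sh | x, y, c) = p(sh | x, c). The kernel \<open>K\<close> built from the
  factors describes \<open>Sh\<close> given (X, Y, C). Tested on sets that ignore \<open>Y\<close>
  it also describes \<open>Sh\<close> given (X, C), so it agrees almost everywhere with the given
  \<open>k\<close>, which may replace it.\<close>

lemma markov_factorization_cond_density:
  fixes NY :: "'y measure" and NX :: "'x measure" and NC :: "'c measure"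
    and NS :: "'s measure" and NSh :: "'t measure" and NYh :: "'u measure"
  assumes "prob_space M"
    and sf: "sigma_finite_measure NY" "sigma_finite_measure NX" "sigma_finite_measure NC"
        "sigma_finite_measure NS" "sigma_finite_measure NSh" "sigma_finite_measure NYh"
    and mf: "markov_factorization M NY NX NC NS NSh NYh Y X C S Sh Yh pY pX pC pS pSh pYh"
    and k: "cond_density_of M (NX \<Otimes>\<^sub>M NC) NSh (\<lambda>w. (X w, C w)) Sh k"
  shows "cond_density_of M (NX \<Otimes>\<^sub>M NY \<Otimes>\<^sub>M NC) NSh (\<lambda>w. (X w, Y w, C w)) Sh (\<lambda>(x, y, c). k (x, c))"
proof -
  interpret M: prob_space M by fact
  interpret NS: sigma_finite_measure NS by fact
  interpret NSh: sigma_finite_measure NSh by fact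
  note [measurable] = markov_factorization_measurable[OF mf]
  interpret XC: conditional_density M NSh "NX \<Otimes>\<^sub>M NC" "\<lambda>w. (X w, C w)" Sh k
    by unfold_locales (use k in auto)
  from mf have pS: "cond_density NX NS pS" and pSh: "cond_density (NS \<Otimes>\<^sub>M NC) NSh pSh"
    by (simp_all add: markov_factorization_def)
  note [measurable (raw)] = cond_density_measurable[OF pS] cond_density_measurable[OF pSh]
  define K where "K x c sh = (\<integral>\<^sup>+ s. ennreal (pS x s * pSh (s, c) sh) \<partial>NS)" for x c sh
  have [measurable (raw)]: "(\<lambda>v. K (f v) (g v) (h v)) \<in> borel_measurable L"
    if [measurable]: "f \<in> measurable L NX" "g \<in> measurable L NC" "h \<in> measurable L NSh" for f g h L
    unfolding K_def by measurable
  note K = markov_factorization_nn_integral[OF sf mf, folded K_def]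
  let ?XC = "distr M (NX \<Otimes>\<^sub>M NC) (\<lambda>w. (X w, C w))"
  let ?XYC = "distr M (NX \<Otimes>\<^sub>M NY \<Otimes>\<^sub>M NC) (\<lambda>w. (X w, Y w, C w))"
  have "density (?XC \<Otimes>\<^sub>M NSh) (\<lambda>p. K (fst (fst p)) (snd (fst p)) (snd p)) = distr M (?XC \<Otimes>\<^sub>M NSh) (\<lambda>w. ((X w, C w), Sh w))"
  proof (rule measure_eqI)
    fix E assume "E \<in> sets (density (?XC \<Otimes>\<^sub>M NSh) (\<lambda>p. K (fst (fst p)) (snd (fst p)) (snd p)))"
    then have [measurable]: "E \<in> sets ((NX \<Otimes>\<^sub>M NC) \<Otimes>\<^sub>M NSh)" by simp
    have "emeasure (density (?XC \<Otimes>\<^sub>M NSh) (\<lambda>p. K (fst (fst p)) (snd (fst p)) (snd p))) E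
        = (\<integral>\<^sup>+ u. \<integral>\<^sup>+ sh. K (fst u) (snd u) sh * indicator E (u, sh) \<partial>NSh \<partial>?XC)"
      by (subst emeasure_density, measurable, subst NSh.nn_integral_fst[symmetric]) auto
    also have "\<dots> = (\<integral>\<^sup>+ w. \<integral>\<^sup>+ sh. K (X w) (C w) sh * indicator E ((X w, C w), sh) \<partial>NSh \<partial>M)"
      by (subst nn_integral_distr) (auto simp: case_prod_beta')
    also have "\<dots> = (\<integral>\<^sup>+ w. indicator E ((X w, C w), Sh w) \<partial>M)"
      by (subst K[of "\<lambda>p. indicator E ((fst (fst p), snd (snd (fst p))), snd p)", simplified, symmetric]) auto
    also have "\<dots> = emeasure (distr M (?XC \<Otimes>\<^sub>M NSh) (\<lambda>w. ((X w, C w), Sh w))) E"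
      by (subst nn_integral_indicator[symmetric], simp, subst nn_integral_distr) auto
    finally show "emeasure (density (?XC \<Otimes>\<^sub>M NSh) (\<lambda>p. K (fst (fst p)) (snd (fst p)) (snd p))) E =
        emeasure (distr M (?XC \<Otimes>\<^sub>M NSh) (\<lambda>w. ((X w, C w), Sh w))) E" .
  qed simp
  also have "\<dots> = density (?XC \<Otimes>\<^sub>M NSh) (\<lambda>(u, sh). ennreal (k u sh))"
    using XC.distributed_pair by (simp add: distributed_def)
  \<comment> \<open>Uniqueness of densities gives equality up to null sets of the product; passing
    to sections makes it usable under the inner integral for almost every \<open>w\<close>.\<close>
  finally have "AE p in ?XC \<Otimes>\<^sub>M NSh. K (fst (fst p)) (snd (fst p)) (snd p) = (case p of (u, sh) \<Rightarrow> ennreal (k u sh))"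
    by (intro XC.UB.density_unique) (auto simp: case_prod_beta')
  then have "AE u in ?XC. AE sh in NSh. K (fst u) (snd u) sh = ennreal (k u sh)"
    using XC.UB.AE_pair by (fastforce simp: case_prod_beta')
  then have Kk: "AE w in M. AE sh in NSh. K (X w) (C w) sh = ennreal (k (X w, C w) sh)"
    by (auto dest!: AE_distrD[rotated])
  have "distr M ((NX \<Otimes>\<^sub>M NY \<Otimes>\<^sub>M NC) \<Otimes>\<^sub>M NSh) (\<lambda>w. ((X w, Y w, C w), Sh w))
      = density (?XYC \<Otimes>\<^sub>M NSh) (\<lambda>(u, sh). ennreal ((case u of (x, y, c) \<Rightarrow> k (x, c)) sh))"
  proof (rule measure_eqI)
    show "sets (distr M ((NX \<Otimes>\<^sub>M NY \<Otimes>\<^sub>M NC) \<Otimes>\<^sub>M NSh) (\<lambda>w. ((X w, Y w, C w), Sh w)))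
      = sets (density (?XYC \<Otimes>\<^sub>M NSh) (\<lambda>(u, sh). ennreal ((case u of (x, y, c) \<Rightarrow> k (x, c)) sh)))"
      by (simp cong: sets_pair_measure_cong)
    fix E assume "E \<in> sets (distr M ((NX \<Otimes>\<^sub>M NY \<Otimes>\<^sub>M NC) \<Otimes>\<^sub>M NSh) (\<lambda>w. ((X w, Y w, C w), Sh w)))"
    then have [measurable]: "E \<in> sets ((NX \<Otimes>\<^sub>M NY \<Otimes>\<^sub>M NC) \<Otimes>\<^sub>M NSh)" by simp
    have "emeasure (distr M ((NX \<Otimes>\<^sub>M NY \<Otimes>\<^sub>M NC) \<Otimes>\<^sub>M NSh) (\<lambda>w. ((X w, Y w, C w), Sh w))) E
       = (\<integral>\<^sup>+ w. indicator E ((X w, Y w, C w), Sh w) \<partial>M)"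
      by (subst nn_integral_indicator[symmetric], simp, subst nn_integral_distr) auto
    also have "\<dots> = (\<integral>\<^sup>+ w. (\<integral>\<^sup>+ sh. K (X w) (C w) sh * indicator E ((X w, Y w, C w), sh) \<partial>NSh) \<partial>M)"
      by (rule K) measurable
    also have "\<dots> = (\<integral>\<^sup>+ w. (\<integral>\<^sup>+ sh. ennreal (k (X w, C w) sh) * indicator E ((X w, Y w, C w), sh) \<partial>NSh) \<partial>M)"
      using Kk by (auto intro!: nn_integral_cong_AE elim!: eventually_mono)
    also have "\<dots> = (\<integral>\<^sup>+ u. \<integral>\<^sup>+ sh. ennreal ((case u of (x, y, c) \<Rightarrow> k (x, c)) sh) * indicator E (u, sh) \<partial>NSh \<partial>?XYC)"
      by (subst nn_integral_distr) (auto simp: case_prod_beta')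
    also have "\<dots> = emeasure (density (?XYC \<Otimes>\<^sub>M NSh) (\<lambda>(u, sh). ennreal ((case u of (x, y, c) \<Rightarrow> k (x, c)) sh))) E"
      by (simp add: case_prod_beta', subst emeasure_density, measurable, subst NSh.nn_integral_fst[symmetric]) auto
    finally show "emeasure (distr M ((NX \<Otimes>\<^sub>M NY \<Otimes>\<^sub>M NC) \<Otimes>\<^sub>M NSh) (\<lambda>w. ((X w, Y w, C w), Sh w))) E =
      emeasure (density (?XYC \<Otimes>\<^sub>M NSh) (\<lambda>(u, sh). ennreal ((case u of (x, y, c) \<Rightarrow> k (x, c)) sh))) E" .
  qed
  moreover have "cond_density (NX \<Otimes>\<^sub>M NY \<Otimes>\<^sub>M NC) NSh (\<lambda>(x, y, c). k (x, c))"
  proof -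
    have "(\<lambda>p. k (fst (fst p), snd (snd (fst p))) (snd p)) \<in> borel_measurable ((NX \<Otimes>\<^sub>M NY \<Otimes>\<^sub>M NC) \<Otimes>\<^sub>M NSh)"
      by measurable
    then show ?thesis
      using XC.cond_density_k unfolding cond_density_def by (auto simp: case_prod_beta' space_pair_measure)
  qed
  ultimately show ?thesis by (simp add: cond_density_of_def)
qed

section \<open>The variational loss as an expectation\<close>

text \<open>
  Without absolute continuity \<^const>\<open>RN_deriv\<close> is 0 and \<open>log b 0 = 0\<close>. This exact value is what makes
  the integrand of \<^const>\<open>L_VIB\<close> measurable, also on the null set where absolute continuity fails.
\<close>

lemma (in sigma_finite_measure) KL_density_density_if:
  fixes f g :: "'a \<Rightarrow> real"
  assumes "1 < b"
    and f[measurable]: "f \<in> borel_measurable M" "AE x in M. 0 \<le> f x"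
    and g[measurable]: "g \<in> borel_measurable M" "AE x in M. 0 \<le> g x"
  shows "KL_divergence b (density M f) (density M g) =
    (if AE x in M. f x = 0 \<longrightarrow> g x = 0 then \<integral>x. g x * log b (g x / f x) \<partial>M else 0)"
proof (cases "AE x in M. f x = 0 \<longrightarrow> g x = 0")
  case True
  then show ?thesis using KL_density_density[OF assms True] by simp
next
  case False
  \<comment> \<open>\<open>RN_deriv\<close> takes its default value 0 only when no derivative
    exists, so every candidate \<open>h\<close> has to be refuted: \<open>f * h = g\<close> almost
    everywhere would force \<open>g\<close> to vanish with \<open>f\<close>.\<close>
  have "\<nexists>h. h \<in> borel_measurable (density M f) \<and> density (density M f) h = density M g"
  proof (rule notI, elim exE conjE)
    fix h assume h: "h \<in> borel_measurable (density M f)" "density (density M f) h = density M g"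
    then have [measurable]: "h \<in> borel_measurable M" by simp
    have "density M (\<lambda>x. ennreal (f x) * h x) = density M g"
      using h by (simp add: density_density_eq)
    then have "AE x in M. ennreal (f x) * h x = ennreal (g x)"
      by (intro density_unique) auto
    then have "AE x in M. f x = 0 \<longrightarrow> g x = 0"
      using g(2) by eventually_elim (auto simp: ennreal_eq_0_iff)
    with False show False by simp
  qed
  then have "RN_deriv (density M f) (density M g) = (\<lambda>_. 0)"
    unfolding RN_deriv_def by (rule if_not_P)
  then show ?thesis
    using False by (simp add: KL_divergence_def entropy_density_def log_def)
qed

text \<open>The encoder is the conditional density of \<open>Sh\<close>, so integrating over it and
  then over (x, y, c) is a single expectation. The care goes into the divergence, which is given by
  the integral of the log ratio only where the encoder is absolutely continuous with respect to
  \<open>r\<close>.\<close>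

lemma L_VIB_eq:
  fixes NX :: "'x measure" and NY :: "'y measure" and NC :: "'c measure"
  assumes "information_space M b" and "sigma_finite_measure NSh"
    and [measurable]: "X \<in> measurable M NX" "Y \<in> measurable M NY" "C \<in> measurable M NC" "Sh \<in> measurable M NSh"
    and k: "cond_density_of M (NX \<Otimes>\<^sub>M NY \<Otimes>\<^sub>M NC) NSh (\<lambda>w. (X w, Y w, C w)) Sh (\<lambda>(x, y, c). k (x, c))"
    and q: "cond_density NSh NY q" and r: "prob_density NSh r"
    and int_q: "integrable M (\<lambda>w. log b (q (Sh w) (Y w)))"
    and r_pos: "AE w in M. 0 < r (Sh w)"
    and int_r: "integrable M (\<lambda>w. log b (k (X w, C w) (Sh w) / r (Sh w)))"
  shows "L_VIB M b NY NX NC NSh Y X C \<beta> q k r =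
    - (\<integral>w. log b (q (Sh w) (Y w)) \<partial>M) + \<beta> * (\<integral>w. log b (k (X w, C w) (Sh w) / r (Sh w)) \<partial>M)"
proof -
  interpret information_space M b by fact
  interpret NSh: sigma_finite_measure NSh by fact
  let ?A = "NX \<Otimes>\<^sub>M NY \<Otimes>\<^sub>M NC" and ?U = "\<lambda>w. (X w, Y w, C w)"
  let ?k = "\<lambda>(x, y, c). k (x, c)"
  interpret V: conditional_density M NSh ?A ?U Sh ?k
    by unfold_locales (use k in auto)
  note [measurable (raw)] = cond_density_measurable[OF q] V.k_measurable
  note [measurable] = prob_densityD(1)[OF r]
  let ?D = "distr M ?A ?U"
  define Lq where "Lq u = (\<integral>sh. ?k u sh * log b (q sh (fst (snd u))) \<partial>NSh)" for u :: "'x \<times> 'y \<times> 'c"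
  define Lr where "Lr u = (\<integral>sh. ?k u sh * log b (?k u sh / r sh) \<partial>NSh)" for u :: "'x \<times> 'y \<times> 'c"
  define ac where "ac u \<longleftrightarrow> (AE sh in NSh. r sh = 0 \<longrightarrow> ?k u sh = 0)" for u :: "'x \<times> 'y \<times> 'c"
  have q_eq: "integrable ?D Lq" "(\<integral>u. Lq u \<partial>?D) = (\<integral>w. log b (q (Sh w) (Y w)) \<partial>M)"
    using V.integral_pair[of "\<lambda>p. log b (q (snd p) (fst (snd (fst p))))"] int_q
    by (simp_all add: Lq_def[abs_def])
  have r_eq: "integrable ?D Lr" "(\<integral>u. Lr u \<partial>?D) = (\<integral>w. log b (k (X w, C w) (Sh w) / r (Sh w)) \<partial>M)"
    using V.integral_pair[of "\<lambda>p. log b (?k (fst p) (snd p) / r (snd p))"] int_r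
    by (simp_all add: Lr_def[abs_def])
  have "AE u in ?D. AE sh in NSh. 0 < ?k u sh \<longrightarrow> 0 < r sh"
    using V.AE_pair[of "\<lambda>p. 0 < r (snd p)"] r_pos by simp
  then have ac_AE: "AE u in ?D. ac u"
    using AE_space
  proof eventually_elim
    case (elim u)
    from elim(1) AE_space show "ac u"
      unfolding ac_def
    proof eventually_elim
      case (elim sh)
      then show ?case using V.k_nonneg[of u sh] \<open>u \<in> space ?D\<close> by auto
    qed
  qed
  \<comment> \<open>\<open>ac\<close> is an almost-everywhere statement with parameter
    \<open>u\<close>. It holds exactly when the indicator of the exceptional set has integral 0, and
    that integral is measurable in \<open>u\<close>.\<close>
  have "Measurable.pred ?A (\<lambda>u. (\<integral>\<^sup>+ sh. indicator {v \<in> space (?A \<Otimes>\<^sub>M NSh). r (snd v) = 0 \<and> ?k (fst v) (snd v) \<noteq> 0} (u, sh) \<partial>NSh) = 0)"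
    by measurable
  also have "?this \<longleftrightarrow> Measurable.pred ?A ac"
  proof (intro measurable_cong)
    fix u assume u: "u \<in> space ?A"
    show "((\<integral>\<^sup>+ sh. indicator {v \<in> space (?A \<Otimes>\<^sub>M NSh). r (snd v) = 0 \<and> ?k (fst v) (snd v) \<noteq> 0} (u, sh) \<partial>NSh) = 0) = ac u"
      unfolding ac_def using u
      by (subst nn_integral_0_iff_AE) (auto simp: space_pair_measure indicator_def intro!: AE_cong)
  qed
  finally have [measurable]: "Measurable.pred ?A ac" .
  have [measurable]: "Lr \<in> borel_measurable ?A" "Lq \<in> borel_measurable ?A"
    using q_eq(1) r_eq(1) by (auto dest: borel_measurable_integrable)
  have "L_VIB M b NY NX NC NSh Y X C \<beta> q k r = (\<integral>u. - Lq u + \<beta> * (if ac u then Lr u else 0) \<partial>?D)"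
    unfolding L_VIB_def
  proof (intro Bochner_Integration.integral_cong refl)
    fix u assume u: "u \<in> space ?D"
    obtain x y c where u_eq: "u = (x, y, c)" by (cases u)
    with u have [simp]: "x \<in> space NX" "y \<in> space NY" "c \<in> space NC" by (auto simp: space_pair_measure)
    have [measurable]: "k (x, c) \<in> borel_measurable NSh"
      using cond_densityD(3)[OF V.cond_density_k, of u] u u_eq by simp
    have nn: "AE sh in NSh. 0 \<le> k (x, c) sh"
      using V.k_nonneg[of u] u u_eq by (intro AE_I2) simp
    show "(case u of (x, y, c) \<Rightarrow> - (\<integral>sh. log b (q sh y) \<partial>density NSh (\<lambda>sh. ennreal (k (x, c) sh)))
        + \<beta> * KL_divergence b (density NSh (\<lambda>sh. ennreal (r sh))) (density NSh (\<lambda>sh. ennreal (k (x, c) sh))))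
      = - Lq u + \<beta> * (if ac u then Lr u else 0)"
      using nn prob_densityD(2)[OF r]
      by (simp add: u_eq integral_density NSh.KL_density_density_if[OF b_gt_1] Lq_def Lr_def ac_def)
  qed
  \<comment> \<open>The default value 0 is taken only on a null set of \<open>u\<close>.\<close>
  also have "\<dots> = (\<integral>u. - Lq u + \<beta> * Lr u \<partial>?D)"
    by (intro integral_cong_AE, measurable) (use ac_AE in eventually_elim, simp)
  also have "\<dots> = - (\<integral>u. Lq u \<partial>?D) + \<beta> * (\<integral>u. Lr u \<partial>?D)"
    using q_eq(1) r_eq(1) by simp
  finally show ?thesis by (simp add: q_eq(2) r_eq(2))
qed

section \<open>The variational upper bound\<close>

text \<open>The encoder is a version of the true conditional density, so both losses refer to one
  joint law. The positivity and integrability hypotheses keep out the default values of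
  \<open>log\<close> at 0 and of divergent integrals.\<close>

theorem corollary1:
  fixes M :: "'w measure" and b \<beta> :: real
    and NY :: "'y measure" and NX :: "'x measure" and NC :: "'c measure"
    and NS :: "'s measure" and NSh :: "'t measure" and NYh :: "'u measure"
    and Y :: "'w \<Rightarrow> 'y" and X :: "'w \<Rightarrow> 'x" and C :: "'w \<Rightarrow> 'c"
    and S :: "'w \<Rightarrow> 's" and Sh :: "'w \<Rightarrow> 't" and Yh :: "'w \<Rightarrow> 'u"
    and pY :: "'y \<Rightarrow> real" and pX :: "'y \<Rightarrow> 'x \<Rightarrow> real" and pC :: "'c \<Rightarrow> real"
    and pS :: "'x \<Rightarrow> 's \<Rightarrow> real" and pSh :: "'s \<times> 'c \<Rightarrow> 't \<Rightarrow> real" and pYh :: "'t \<Rightarrow> 'u \<Rightarrow> real"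
    and q :: "'t \<Rightarrow> 'y \<Rightarrow> real" and p\<theta> :: "'x \<times> 'c \<Rightarrow> 't \<Rightarrow> real" and r :: "'t \<Rightarrow> real"
  assumes "information_space M b"
    and "sigma_finite_measure NY" "sigma_finite_measure NX" "sigma_finite_measure NC"
        "sigma_finite_measure NS" "sigma_finite_measure NSh" "sigma_finite_measure NYh"
    and "markov_factorization M NY NX NC NS NSh NYh Y X C S Sh Yh pY pX pC pS pSh pYh"
    and "0 \<le> \<beta>"
    and "cond_density NSh NY q"
    and "cond_density_of M (NX \<Otimes>\<^sub>M NC) NSh (\<lambda>w. (X w, C w)) Sh p\<theta>"
    and "prob_density NSh r"
    and "information_space.finite_entropy M b NY Y pY"
    and "0 \<le> prob_space.entropy M b NY Y"
    and "AE w in M. 0 < q (Sh w) (Y w)"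
    and "integrable M (\<lambda>w. log b (q (Sh w) (Y w)))"
    and "AE w in M. 0 < r (Sh w)"
    and "integrable M (\<lambda>w. log b (p\<theta> (X w, C w) (Sh w) / r (Sh w)))"
  shows "L_VIB M b NY NX NC NSh Y X C \<beta> q p\<theta> r \<ge> L_IB M b NY NX NC NSh Y X C Sh \<beta>"
proof -
  interpret information_space M b by fact
  interpret NY: sigma_finite_measure NY by fact
  interpret NSh: sigma_finite_measure NSh by fact
  interpret P: pair_sigma_finite NSh NY ..
  note mf = assms(8) and q = assms(10) and k = assms(11) and r = assms(12)
  note fe = assms(13) and H_nonneg = assms(14) and q_pos = assms(15) and int_q = assms(16)
  note r_pos = assms(17) and int_r = assms(18)
  note [measurable] = markov_factorization_measurable[OF mf]
  let ?A = "NX \<Otimes>\<^sub>M NY \<Otimes>\<^sub>M NC" and ?U = "\<lambda>w. (X w, Y w, C w)"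
  let ?k = "\<lambda>(x, y, c). p\<theta> (x, c)"
  have k3: "cond_density_of M ?A NSh ?U Sh ?k"
    by (rule markov_factorization_cond_density[OF prob_space_axioms assms(2-7) mf k])
  \<comment> \<open>The same density is used under two conditions: \<open>V\<close> handles
    integrands that involve \<open>Y\<close>, \<open>XC\<close> the rate.\<close>
  interpret V: conditional_density M NSh ?A ?U Sh ?k
    by unfold_locales (use k3 in auto)
  interpret XC: conditional_density M NSh "NX \<Otimes>\<^sub>M NC" "\<lambda>w. (X w, C w)" Sh p\<theta>
    by unfold_locales (use k in auto)
  have dY: "distributed M NY Y (\<lambda>y. ennreal (pY y))"
    using finite_entropy_distributed[OF fe] .
  have pY_nonneg: "\<And>y. y \<in> space NY \<Longrightarrow> 0 \<le> pY y" and [measurable]: "pY \<in> borel_measurable NY"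
    using finite_entropy_nn[OF fe] finite_entropy_measurable[OF fe] by auto
  \<comment> \<open>No density of \<open>Sh\<close> or of (Sh, Y) is given by name. Both exist by
    Radon-Nikodym: absolute continuity comes from the conditional density of \<open>Sh\<close> and,
    for the pair, also from the density of \<open>Y\<close>.\<close>
  obtain m where [measurable]: "m \<in> borel_measurable NSh" and m_nonneg: "\<And>sh. 0 \<le> m sh"
    and dm: "distributed M NSh Sh (\<lambda>sh. ennreal (m sh))"
    by (rule absolutely_continuous_real_density[OF NSh.sigma_finite_measure_axioms _ V.absolutely_continuous_Z]) auto
  have "absolutely_continuous NY (distr M NY Y)"
    using dY by (auto simp: distributed_def absolutely_continuousI_density)
  then have ac: "absolutely_continuous (NSh \<Otimes>\<^sub>M NY) (distr M (NSh \<Otimes>\<^sub>M NY) (\<lambda>w. (Sh w, Y w)))"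
    using V.absolutely_continuous_pair[of "\<lambda>u. fst (snd u)" NY] assms(2) by simp
  obtain j where [measurable]: "j \<in> borel_measurable (NSh \<Otimes>\<^sub>M NY)" and j_nonneg: "\<And>p. 0 \<le> j p"
    and dj: "distributed M (NSh \<Otimes>\<^sub>M NY) (\<lambda>w. (Sh w, Y w)) (\<lambda>p. ennreal (j p))"
    by (rule absolutely_continuous_real_density[OF P.sigma_finite_measure_axioms _ ac]) auto
  note [measurable (raw)] = cond_density_measurable[OF q] XC.k_measurable
  note [measurable] = prob_densityD(1)[OF r]
  let ?j = "\<lambda>w. j (Sh w, Y w)" and ?m = "\<lambda>w. m (Sh w)" and ?y = "\<lambda>w. pY (Y w)"
    and ?t = "\<lambda>w. p\<theta> (X w, C w) (Sh w)" and ?r = "\<lambda>w. r (Sh w)" and ?q = "\<lambda>w. q (Sh w) (Y w)"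
  have pos: "AE w in M. 0 < ?j w \<and> 0 < ?m w \<and> 0 < ?y w \<and> 0 < ?t w \<and> 0 < ?r w \<and> 0 < ?q w"
    using distributed_AE_pos[OF dj] distributed_AE_pos[OF dm] distributed_AE_pos[OF dY] XC.AE_k_pos r_pos q_pos
    by (auto simp: AE_conj_iff)
  have m1: "(\<integral>\<^sup>+ sh. ennreal (m sh) \<partial>NSh) = 1"
    using distributed_nn_integral[OF dm, of "\<lambda>_. 1"] by (simp add: emeasure_space_1)
  have j1: "(\<integral>\<^sup>+ p. ennreal (j p) \<partial>(NSh \<Otimes>\<^sub>M NY)) = 1"
    using distributed_nn_integral[OF dj, of "\<lambda>_. 1"] by (simp add: emeasure_space_1)
  have y1: "(\<integral>\<^sup>+ y. ennreal (pY y) \<partial>NY) = 1"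
    using distributed_nn_integral[OF dY, of "\<lambda>_. 1"] by (simp add: emeasure_space_1)
  have rm: "(\<integral>\<^sup>+ w. ennreal (?r w / ?m w) \<partial>M) \<le> 1"
    using nn_integral_density_ratio_le[OF dm, of r] prob_densityD[OF r] by simp
  have mt: "(\<integral>\<^sup>+ w. ennreal (?m w / ?t w) \<partial>M) \<le> 1"
    using XC.nn_integral_quotient_le[of "\<lambda>p. m (snd p)"] m_nonneg by (simp add: m1 emeasure_space_1)
  \<comment> \<open>\<open>j / pY\<close> is the conditional density of \<open>Sh\<close> given
    \<open>Y\<close>, compared here with the one given (X, C). By the Markov property
    \<open>V\<close> cancels \<open>p\<theta>\<close> although the numerator involves
    \<open>Y\<close>; then \<open>pY\<close> cancels and \<open>j\<close> has integral 1.\<close>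
  have jyt: "(\<integral>\<^sup>+ w. ennreal (?j w / (?y w * ?t w)) \<partial>M) \<le> 1"
  proof -
    have "(\<integral>\<^sup>+ w. ennreal (?j w / (?y w * ?t w)) \<partial>M) \<le> (\<integral>\<^sup>+ w. \<integral>\<^sup>+ sh. ennreal (j (sh, Y w) / ?y w) \<partial>NSh \<partial>M)"
      using V.nn_integral_quotient_le[of "\<lambda>p. j (snd p, fst (snd (fst p))) / pY (fst (snd (fst p)))"] j_nonneg pY_nonneg
      by (auto simp: space_pair_measure)
    also have "\<dots> = (\<integral>\<^sup>+ y. ennreal (pY y) * (\<integral>\<^sup>+ sh. ennreal (j (sh, y) / pY y) \<partial>NSh) \<partial>NY)"
      by (rule distributed_nn_integral[OF dY, symmetric]) measurable
    also have "\<dots> \<le> (\<integral>\<^sup>+ y. \<integral>\<^sup>+ sh. ennreal (j (sh, y)) \<partial>NSh \<partial>NY)"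
    proof (rule nn_integral_mono)
      fix y assume [simp]: "y \<in> space NY"
      have "ennreal (pY y) * (\<integral>\<^sup>+ sh. ennreal (j (sh, y) / pY y) \<partial>NSh)
          = (\<integral>\<^sup>+ sh. ennreal (pY y) * ennreal (j (sh, y) / pY y) \<partial>NSh)"
        by (rule nn_integral_cmult[symmetric]) measurable
      also have "\<dots> \<le> (\<integral>\<^sup>+ sh. ennreal (j (sh, y)) \<partial>NSh)"
        using pY_nonneg[of y] j_nonneg
        by (intro nn_integral_mono, cases "pY y = 0") (auto simp: ennreal_mult[symmetric])
      finally show "ennreal (pY y) * (\<integral>\<^sup>+ sh. ennreal (j (sh, y) / pY y) \<partial>NSh) \<le> (\<integral>\<^sup>+ sh. ennreal (j (sh, y)) \<partial>NSh)" .
    qed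
    also have "\<dots> = 1"
      by (subst P.nn_integral_snd) (simp_all add: j1)
    finally show ?thesis .
  qed
  have myj: "(\<integral>\<^sup>+ w. ennreal (?m w * ?y w / ?j w) \<partial>M) \<le> 1"
  proof -
    have "(\<integral>\<^sup>+ p. ennreal (m (fst p) * pY (snd p)) \<partial>(NSh \<Otimes>\<^sub>M NY))
        = (\<integral>\<^sup>+ sh. \<integral>\<^sup>+ y. ennreal (m sh) * ennreal (pY y) \<partial>NY \<partial>NSh)"
      by (subst NY.nn_integral_fst[symmetric]) (auto simp: m_nonneg pY_nonneg ennreal_mult intro!: nn_integral_cong)
    also have "\<dots> = 1" by (simp add: nn_integral_cmult y1 m1)
    finally show ?thesis
      using nn_integral_density_ratio_le[OF dj, of "\<lambda>p. m (fst p) * pY (snd p)"] m_nonneg pY_nonneg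
      by (auto simp: space_pair_measure)
  qed
  \<comment> \<open>\<open>q\<close> times \<open>m\<close> is a probability density on pairs (sh,
    y): the decoder joined to the true marginal.\<close>
  have qmj: "(\<integral>\<^sup>+ w. ennreal (?q w * ?m w / ?j w) \<partial>M) \<le> 1"
  proof -
    have "(\<integral>\<^sup>+ p. ennreal (q (fst p) (snd p) * m (fst p)) \<partial>(NSh \<Otimes>\<^sub>M NY))
        = (\<integral>\<^sup>+ sh. \<integral>\<^sup>+ y. ennreal (m sh) * ennreal (q sh y) \<partial>NY \<partial>NSh)"
      by (subst NY.nn_integral_fst[symmetric])
        (auto simp: m_nonneg cond_densityD(2)[OF q] ennreal_mult ac_simps intro!: nn_integral_cong)
    also have "\<dots> = (\<integral>\<^sup>+ sh. ennreal (m sh) \<partial>NSh)"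
      by (intro nn_integral_cong, subst nn_integral_cmult) (simp_all add: cond_densityD(3,4)[OF q])
    finally show ?thesis
      using nn_integral_density_ratio_le[OF dj, of "\<lambda>p. q (fst p) (snd p) * m (fst p)"] m_nonneg cond_densityD(2)[OF q] m1
      by (auto simp: space_pair_measure)
  qed

  \<comment> \<open>The rate term\<close>
  have int_cong: "integrable M f \<longleftrightarrow> integrable M g"
    if [measurable]: "f \<in> borel_measurable M" "g \<in> borel_measurable M" and "AE w in M. f w = g w" for f g :: "'w \<Rightarrow> real"
    using that by (intro integrable_cong_AE)
  \<comment> \<open>The sign is arranged so that both logarithms on the right are of ratios with
    expectation at most 1. Their positive parts are then integrable, and
    \<open>integrable_summand\<close> separates them.\<close>
  have log_tr: "AE w in M. log b (?t w / ?r w) = - (log b (?m w / ?t w) + log b (?r w / ?m w))"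
    using pos by eventually_elim (simp add: log_divide)
  have sum1: "integrable M (\<lambda>w. log b (?m w / ?t w) + log b (?r w / ?m w))"
    using Bochner_Integration.integrable_minus[OF iffD1[OF int_cong[OF _ _ log_tr] int_r]] by (simp add: add.commute)
  have fin_mt: "(\<integral>\<^sup>+ w. ennreal (log b (?m w / ?t w)) \<partial>M) < \<infinity>"
    by (intro nn_integral_log_finite mt, measurable) (use pos in eventually_elim, simp)
  have fin_rm: "(\<integral>\<^sup>+ w. ennreal (log b (?r w / ?m w)) \<partial>M) < \<infinity>"
    by (intro nn_integral_log_finite rm, measurable) (use pos in eventually_elim, simp)
  have int_mt: "integrable M (\<lambda>w. log b (?m w / ?t w))"
    by (rule integrable_summand[OF _ _ fin_mt fin_rm sum1]) measurable
  have int_rm: "integrable M (\<lambda>w. log b (?r w / ?m w))"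
    using Bochner_Integration.integrable_diff[OF sum1 int_mt] by simp
  \<comment> \<open>The negative of this expectation is the divergence of the law of
    \<open>Sh\<close> from \<open>r\<close>, the slack in the rate term.\<close>
  have r_le: "expectation (\<lambda>w. log b (?r w / ?m w)) \<le> 0"
    by (intro expectation_log_nonpos rm int_rm, measurable) (use pos in eventually_elim, simp)
  have "expectation (\<lambda>w. log b (?t w / ?r w)) = expectation (\<lambda>w. - (log b (?m w / ?t w) + log b (?r w / ?m w)))"
    using log_tr by (intro integral_cong_AE) auto
  also have "\<dots> = - expectation (\<lambda>w. log b (?m w / ?t w)) - expectation (\<lambda>w. log b (?r w / ?m w))"
    using int_mt int_rm by simp
  finally have rate: "- expectation (\<lambda>w. log b (?m w / ?t w)) \<le> expectation (\<lambda>w. log b (?t w / ?r w))"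
    using r_le by simp
  have "mutual_information b NSh (NX \<Otimes>\<^sub>M NC) Sh (\<lambda>w. (X w, C w)) = expectation (\<lambda>w. log b (?t w / ?m w))"
    by (rule XC.mutual_information_eq[OF b_gt_1 dm m_nonneg])
  also have "\<dots> = expectation (\<lambda>w. - log b (?m w / ?t w))"
    by (rule integral_cong_AE, measurable) (use pos in eventually_elim, simp add: log_divide)
  finally have I_rate: "mutual_information b NSh (NX \<Otimes>\<^sub>M NC) Sh (\<lambda>w. (X w, C w)) \<le> expectation (\<lambda>w. log b (?t w / ?r w))"
    using rate by simp

  \<comment> \<open>The distortion term\<close>
  \<comment> \<open>Data processing as a factorization: \<open>m / p\<theta>\<close> is
    \<open>m * pY / j\<close> times \<open>j / (pY * p\<theta>)\<close>. The logarithm of the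
    product is integrable by the rate part and both factors have expectation at most 1, so the
    information density of (Sh, Y) is integrable.\<close>
  have log_sum: "AE w in M. log b (?m w / ?t w) = log b (?m w * ?y w / ?j w) + log b (?j w / (?y w * ?t w))"
    using pos by eventually_elim (simp add: log_divide log_mult)
  have sum2: "integrable M (\<lambda>w. log b (?m w * ?y w / ?j w) + log b (?j w / (?y w * ?t w)))"
    using int_mt int_cong[OF _ _ log_sum] by simp
  have fin_myj: "(\<integral>\<^sup>+ w. ennreal (log b (?m w * ?y w / ?j w)) \<partial>M) < \<infinity>"
    by (intro nn_integral_log_finite myj, measurable) (use pos in eventually_elim, simp)
  have fin_jyt: "(\<integral>\<^sup>+ w. ennreal (log b (?j w / (?y w * ?t w))) \<partial>M) < \<infinity>"
    by (intro nn_integral_log_finite jyt, measurable) (use pos in eventually_elim, simp)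
  have int_myj: "integrable M (\<lambda>w. log b (?m w * ?y w / ?j w))"
    by (rule integrable_summand[OF _ _ fin_myj fin_jyt sum2]) measurable
  have int_y: "integrable M (\<lambda>w. log b (?y w))"
    using finite_entropy_integrable[OF fe] pY_nonneg by (subst distributed_integrable[OF dY, symmetric]) auto
  have H: "entropy b NY Y = - expectation (\<lambda>w. log b (?y w))"
    using entropy_distr[OF dY pY_nonneg] distributed_integral[OF dY _ pY_nonneg, of "\<lambda>y. log b (pY y)"] by simp
  \<comment> \<open>Dividing by \<open>pY\<close> brings in the entropy: the nonpositive expectation
    reads E log q \<le> I(Sh; Y) - H(Y), and \<open>dist\<close> drops H(Y) by its sign.\<close>
  have log_qmj: "AE w in M. log b (?q w * ?m w / ?j w) = log b (?q w) + log b (?m w * ?y w / ?j w) - log b (?y w)"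
    using pos by eventually_elim (simp add: log_divide log_mult)
  have int_qmj: "integrable M (\<lambda>w. log b (?q w * ?m w / ?j w))"
    by (subst int_cong[OF _ _ log_qmj]) (use int_q int_myj int_y in auto)
  have "expectation (\<lambda>w. log b (?q w)) + expectation (\<lambda>w. log b (?m w * ?y w / ?j w)) - expectation (\<lambda>w. log b (?y w))
      = expectation (\<lambda>w. log b (?q w * ?m w / ?j w))"
    by (subst integral_cong_AE[OF _ _ log_qmj]) (use int_q int_myj int_y in auto)
  also have "\<dots> \<le> 0"
    by (intro expectation_log_nonpos qmj int_qmj, measurable) (use pos in eventually_elim, simp)
  finally have dist: "expectation (\<lambda>w. log b (?q w)) \<le> - expectation (\<lambda>w. log b (?m w * ?y w / ?j w))"
    using H H_nonneg by simp
  have "mutual_information b NSh NY Sh Y = (\<integral>p. j p * log b (j p / (m (fst p) * pY (snd p))) \<partial>(NSh \<Otimes>\<^sub>M NY))"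
    using m_nonneg pY_nonneg j_nonneg
    by (intro mutual_information_distr[OF assms(6,2) dm _ dY _ dj]) auto
  also have "\<dots> = expectation (\<lambda>w. log b (?j w / (?m w * ?y w)))"
    using distributed_integral[OF dj, of "\<lambda>p. log b (j p / (m (fst p) * pY (snd p)))"] j_nonneg by simp
  also have "\<dots> = expectation (\<lambda>w. - log b (?m w * ?y w / ?j w))"
    by (rule integral_cong_AE, measurable) (use pos in eventually_elim, simp add: log_divide log_mult)
  finally have I_dist: "expectation (\<lambda>w. log b (?q w)) \<le> mutual_information b NSh NY Sh Y"
    using dist by simp

  \<comment> \<open>Combination of the two terms\<close>
  have "L_VIB M b NY NX NC NSh Y X C \<beta> q p\<theta> r
      = - expectation (\<lambda>w. log b (?q w)) + \<beta> * expectation (\<lambda>w. log b (?t w / ?r w))"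
    by (rule L_VIB_eq[OF assms(1,6) _ _ _ _ k3 q r int_q r_pos int_r]) measurable
  then show ?thesis
    unfolding L_IB_def using I_dist mult_left_mono[OF I_rate \<open>0 \<le> \<beta>\<close>] by simp
qed

end
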